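(* Let $q\ge 4$ be a fixed even integer. For even positive integers $n$, the number $M_{\rm CPB}(n,q)$ of sequences of length $n$ over ${\cal A}_q$ that are both charge-balanced and polarity-balanced satisfies $$M_{\rm CPB}(n,q)\approx q^n\,\frac{1}{\pi n}\sqrt{\frac{48}{q^2-4}},$$ where $\approx$ means that the ratio of the two sides tends to $1$ as $n\to\infty$ through even integers.
   Context: For an integer $q\ge 2$, ${\cal A}_q=\{-q+1,-q+3,-q+5,\ldots,q-3,q-1\}$ (a set of $q$ integers). A sequence ${\bf x}=(x_1,\ldots,x_n)\in({\cal A}_q)^n$ is charge-balanced (CB) if $\sum_{i=1}^n x_i=0$, polarity-balanced (PB) if $|\{i:x_i>0\}|=|\{i:x_i<0\}|$, and charge and polarity balanced (CPB) if it is both CB and PB. $M_{\rm CPB}(n,q)$ is the number of CPB sequences in $({\cal A}_q)^n$. *)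

theory Defs
  imports Complex_Main
begin

definition alphabet :: "nat \<Rightarrow> int set" where
  "alphabet q = {2 * int k - int q + 1 | k. k < q}"

definition charge_balanced :: "int list \<Rightarrow> bool" where
  "charge_balanced xs \<longleftrightarrow> sum_list xs = 0"

definition polarity_balanced :: "int list \<Rightarrow> bool" where
  "polarity_balanced xs \<longleftrightarrow>
     card {i. i < length xs \<and> xs ! i > 0} = card {i. i < length xs \<and> xs ! i < 0}"

definition CPB_sequences :: "nat \<Rightarrow> nat \<Rightarrow> int list set" where
  "CPB_sequences n q =
     {xs. length xs = n \<and> set xs \<subseteq> alphabet q \<and> charge_balanced xs \<and> polarity_balanced xs}"

definition M_CPB :: "nat \<Rightarrow> nat \<Rightarrow> nat" where
  "M_CPB n q = card (CPB_sequences n q)"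

end

theory Submission
  imports Defs "HOL-Probability.Distributions" "HOL-Real_Asymp.Real_Asymp"
begin

text \<open>
  Put \<open>n = 2 m\<close>, \<open>q = 2 k\<close>. In the generating function of the balanced sequences, the choice of the
  \<open>m\<close> positive positions contributes a central binomial coefficient, and the moduli contribute
  \<open>\<bar>P t\<bar> ^ (2 m)\<close> with \<open>P t = (\<Sum>j<k. cis (t (j + 1/2)))\<close>. Charge balance is extracted by integrating over
  \<open>[-\<pi>, \<pi>]\<close>. After the substitution \<open>t = s / sqrt m\<close> the normalised integrand tends to a Gaussian and is
  dominated by another one; the central binomial coefficient is handled by Wallis's product.
\<close>

section \<open>Weighted enumeration of lists by the number of entries in \<open>A\<close>\<close>

definition lists_with_count :: "'a set \<Rightarrow> 'a set \<Rightarrow> nat \<Rightarrow> nat \<Rightarrow> 'a list set" where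
  "lists_with_count A B n j =
     {xs. length xs = n \<and> set xs \<subseteq> A \<union> B \<and> length (filter (\<lambda>x. x \<in> A) xs) = j}"

lemma finite_lists_with_count:
  assumes "finite A" "finite B"
  shows "finite (lists_with_count A B n j)"
  by (rule finite_subset[OF _ finite_lists_length_eq[of "A \<union> B" n]])
     (use assms in \<open>auto simp: lists_with_count_def\<close>)

text \<open>This is the coefficient of z^j in (z * sum g A + sum g B)^n. The induction splits off
  the first letter and follows Pascal's rule.\<close>

lemma sum_prod_list_lists_with_count:
  fixes g :: "'a \<Rightarrow> 'b :: comm_semiring_1"
  assumes fin: "finite A" "finite B" and disj: "A \<inter> B = {}"
  shows "(\<Sum>xs\<in>lists_with_count A B n j. prod_list (map g xs)) =
           of_nat (n choose j) * sum g A ^ j * sum g B ^ (n - j)"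
proof (induction n arbitrary: j)
  case 0
  have "lists_with_count A B 0 j = (if j = 0 then {[]} else {})"
    by (auto simp: lists_with_count_def)
  then show ?case by (cases j) auto
next
  case (Suc n)
  let ?L = "lists_with_count A B"
  let ?c = "\<lambda>(x, xs). x # xs"
  have inj: "inj_on ?c X" for X :: "('a \<times> 'a list) set"
    by (auto simp: inj_on_def)
  have sum_cons: "(\<Sum>xs\<in>?c ` (C \<times> L). prod_list (map g xs)) =
      sum g C * (\<Sum>xs\<in>L. prod_list (map g xs))" for C L
    by (subst sum.reindex[OF inj])
       (simp add: o_def case_prod_unfold sum_product sum.cartesian_product)
  show ?case
  proof (cases j)
    case 0
    have "?L (Suc n) 0 = ?c ` (B \<times> ?L n 0)"
      using disj by (fastforce simp: lists_with_count_def length_Suc_conv image_iff split: if_splits)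
    then show ?thesis by (simp only: sum_cons Suc.IH 0) simp
  next
    case (Suc i)
    have split: "?L (Suc n) (Suc i) = ?c ` (A \<times> ?L n i) \<union> ?c ` (B \<times> ?L n (Suc i))"
      using disj
      apply (intro equalityI subsetI)
      subgoal for xs by (cases xs) (auto simp: lists_with_count_def image_iff split: if_splits)
      subgoal by (auto simp: lists_with_count_def)
      done
    have "(\<Sum>xs\<in>?L (Suc n) (Suc i). prod_list (map g xs)) =
        sum g A * (of_nat (n choose i) * sum g A ^ i * sum g B ^ (n - i)) +
        sum g B * (of_nat (n choose Suc i) * sum g A ^ Suc i * sum g B ^ (n - Suc i))"
      unfolding split Suc.IH[symmetric] sum_cons[symmetric]
      by (rule sum.union_disjoint) (use fin disj in \<open>auto simp: finite_lists_with_count\<close>)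
    also have "\<dots> = of_nat (Suc n choose Suc i) * sum g A ^ Suc i * sum g B ^ (Suc n - Suc i)"
    \<comment> \<open>Subtraction truncates: for i >= n the exponent \<open>n - Suc i\<close> is no
      longer one less than \<open>n - i\<close>, but then the binomial coefficient
      \<open>n choose Suc i\<close> vanishes.\<close>
    proof (cases "i < n")
      case True
      then have "sum g B ^ (n - i) = sum g B * sum g B ^ (n - Suc i)"
        by (metis Suc_diff_Suc power_Suc)
      then show ?thesis by (simp add: algebra_simps)
    next
      case False
      then show ?thesis by (simp add: algebra_simps binomial_eq_0)
    qed
    finally show ?thesis using Suc by simp
  qed
qed

section \<open>Exponential sums, the cosine kernel and Fourier orthogonality\<close>

lemma prod_list_cis:
  "prod_list (map (\<lambda>x. cis (f x)) xs) = cis (\<Sum>x\<leftarrow>xs. f x)"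
  by (induction xs) (simp_all add: cis_mult)

text \<open>This is \<open>\<bar>\<Sum>j<k. cis (j t)\<bar>\<^sup>2\<close>, hence nonnegative.\<close>
definition cos_kernel :: "nat \<Rightarrow> real \<Rightarrow> real" where
  "cos_kernel k t = (\<Sum>i<k. \<Sum>j<k. cos ((real i - real j) * t))"

text \<open>The two factors are complex conjugates, so the product is real, and the common phase
  \<open>t * c\<close> cancels. The shift 1/2 serves the counting and the shift 0 gives
  nonnegativity.\<close>

lemma sum_cis_mult_sum_cis:
  fixes c :: real
  shows "(\<Sum>j<k. cis (t * (real j + c))) * (\<Sum>j<k. cis (- (t * (real j + c)))) =
    of_real (cos_kernel k t)" (is "?P * ?Q = _")
proof -
  have "?Q = cnj ?P" by (simp add: cis_cnj)
  then have Q: "?P * ?Q = of_real ((cmod ?P)\<^sup>2)" by (simp only: complex_norm_square)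
  have prod: "?P * ?Q = (\<Sum>i<k. \<Sum>j<k. cis ((real i - real j) * t))"
    by (simp add: sum_product cis_mult algebra_simps)
  have "Re (?P * ?Q) = cos_kernel k t"
    unfolding prod by (simp add: cos_kernel_def)
  moreover have "Im (?P * ?Q) = 0" unfolding Q by simp
  ultimately show ?thesis by (simp add: complex_eq_iff)
qed

lemma cos_kernel_nonneg: "cos_kernel k t \<ge> 0"
proof -
  have "complex_of_real (cos_kernel k t) =
      (\<Sum>j<k. cis (t * (real j + 0))) * cnj (\<Sum>j<k. cis (t * (real j + 0)))"
    by (subst sum_cis_mult_sum_cis[of t 0 k, symmetric]) (simp add: cis_cnj)
  then have "complex_of_real (cos_kernel k t) =
      of_real ((cmod (\<Sum>j<k. cis (t * (real j + 0))))\<^sup>2)"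
    by (simp only: complex_norm_square)
  then show ?thesis by (simp only: of_real_eq_iff) simp
qed

text \<open>Orthogonality with the constant mode; it will single out the lists whose sum is
  zero.\<close>

lemma integral_cos_int:
  "(LBINT t. indicator {-pi..pi} t * cos (t * of_int z)) = (if z = 0 then 2 * pi else 0)"
proof (cases "z = 0")
  case True
  then show ?thesis by simp
next
  case False
  have "(LBINT t. indicator {-pi..pi} t *\<^sub>R cos (t * of_int z)) =
      sin (pi * of_int z) / of_int z - sin (- pi * of_int z) / of_int z"
    by (rule integral_FTC_atLeastAtMost)
       (use False in \<open>auto intro!: derivative_eq_intros continuous_intros
         simp flip: has_real_derivative_iff_has_vector_derivative\<close>)
  moreover have "sin (pi * of_int z) = 0"
    by (metis sin_zero_iff_int2 mult.commute)
  ultimately show ?thesis using False by simp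
qed

section \<open>Gaussian bound for the kernel on [-pi, pi]\<close>

lemma one_minus_cos_ge:
  fixes t :: real
  assumes "\<bar>t\<bar> \<le> pi"
  shows "t\<^sup>2 / 8 \<le> 1 - cos t"
proof -
  \<comment> \<open>By the half-angle formula 1 - cos t = 2 (sin x)^2, so sin x >= x/2 suffices.
    This follows from sin x >= x - x^3/6, because x <= pi/2 < 1.6 gives x^2 <= 2.56 < 3.\<close>
  define x where "x = \<bar>t\<bar> / 2"
  have x: "0 \<le> x" "x \<le> 1.6" using assms pi_approx by (auto simp: x_def)
  have "\<bar>sin x - x\<bar> \<le> x ^ 3 / 6"
  proof -
    have "(\<Sum>m<3. sin_coeff m * x ^ m) = x" by (simp add: numeral_3_eq_3 sin_coeff_def)
    moreover have "inverse (fact 3) * \<bar>x\<bar> ^ 3 = x ^ 3 / 6"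
      using x by (simp add: fact_numeral)
    ultimately show ?thesis using Maclaurin_sin_bound[of x 3] by simp
  qed
  moreover have "x ^ 3 \<le> x * 3"
  proof -
    have "x * x \<le> 1.6 * 1.6" using x by (intro mult_mono) auto
    then have "x * (x * x) \<le> x * 3" using x by (intro mult_left_mono) auto
    then show ?thesis by (simp add: power3_eq_cube mult.assoc)
  qed
  ultimately have "x / 2 \<le> sin x" by linarith
  then have "(x / 2)\<^sup>2 \<le> (sin x)\<^sup>2" using x by (intro power_mono) auto
  moreover have "1 - cos t = 2 * (sin x)\<^sup>2"
    using cos_double_sin[of x] by (simp add: x_def)
  ultimately show ?thesis by (simp add: x_def power_divide)
qed

text \<open>With \<open>t = s / sqrt m\<close>, the m-th power of the right-hand side is a Gaussian
  in \<open>s\<close> free of \<open>m\<close>, as dominated convergence requires. The rate is not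
  sharp; any positive one would do.\<close>

lemma cos_kernel_le_exp:
  assumes k: "k \<ge> 2" and t: "\<bar>t\<bar> \<le> pi"
  shows "cos_kernel k t / (real k)\<^sup>2 \<le> exp (- (t\<^sup>2 / (8 * (real k)\<^sup>2)))"
proof -
  \<comment> \<open>The terms with \<open>{i, j} = {0, 1}\<close> alone already force the Gaussian decay.\<close>
  have ik: "{..<k} = insert 0 (insert 1 {2..<k})" using k by auto
  have "1 - cos t \<le> (\<Sum>j<k. 1 - cos ((real 0 - real j) * t))"
    unfolding ik by (simp add: sum_nonneg)
  also have "\<dots> \<le> (\<Sum>i<k. \<Sum>j<k. 1 - cos ((real i - real j) * t))"
    by (rule member_le_sum) (use k in \<open>auto intro!: sum_nonneg\<close>)
  also have "\<dots> = (real k)\<^sup>2 - cos_kernel k t"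
    by (simp add: cos_kernel_def sum_subtractf power2_eq_square)
  finally have "cos_kernel k t \<le> (real k)\<^sup>2 - t\<^sup>2 / 8"
    using one_minus_cos_ge[OF t] by linarith
  then have "cos_kernel k t / (real k)\<^sup>2 \<le> 1 - t\<^sup>2 / (8 * (real k)\<^sup>2)"
    using k by (simp add: field_simps)
  also have "\<dots> \<le> exp (- (t\<^sup>2 / (8 * (real k)\<^sup>2)))"
    using exp_ge_add_one_self[of "- (t\<^sup>2 / (8 * (real k)\<^sup>2))"] by linarith
  finally show ?thesis .
qed

section \<open>Pointwise limit of the rescaled kernel powers\<close>

lemma cos_kernel_le: "cos_kernel k t \<le> (real k)\<^sup>2"
proof -
  have "cos_kernel k t \<le> (\<Sum>i<k. \<Sum>j<k. 1)"
    unfolding cos_kernel_def by (intro sum_mono) auto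
  then show ?thesis by (simp add: power2_eq_square)
qed

text \<open>The double sum is minus the second derivative of \<open>cos_kernel k\<close> at 0.
  Divided by 2 k^2 it yields the rate (k^2 - 1)/12 of the limiting Gaussian.\<close>

lemma sum_squared_differences:
  "(\<Sum>i<k. \<Sum>j<k. (real i - real j)\<^sup>2) = (real k)\<^sup>2 * ((real k)\<^sup>2 - 1) / 6"
proof -
  have s1: "(\<Sum>i<k. real i) = real k * (real k - 1) / 2"
    by (induction k) (auto simp: field_simps)
  have s2: "(\<Sum>i<k. (real i)\<^sup>2) = real k * (real k - 1) * (2 * real k - 1) / 6"
    by (induction k) (auto simp: field_simps power2_eq_square)
  have "(\<Sum>i<k. \<Sum>j<k. (real i - real j)\<^sup>2) =
      (\<Sum>i<k. \<Sum>j<k. (real i)\<^sup>2 + (real j)\<^sup>2 - 2 * (real i * real j))"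
    by (intro sum.cong refl) (simp add: power2_eq_square algebra_simps)
  also have "\<dots> = 2 * real k * (\<Sum>i<k. (real i)\<^sup>2) - 2 * (\<Sum>i<k. real i)\<^sup>2"
    by (simp add: sum.distrib sum_subtractf power2_eq_square sum_product
        flip: sum_distrib_left)
  also have "\<dots> = (real k)\<^sup>2 * ((real k)\<^sup>2 - 1) / 6"
    unfolding s1 s2 by (simp add: field_simps power2_eq_square)
  finally show ?thesis .
qed

lemma cos_scaled_tendsto:
  fixes c :: real
  shows "(\<lambda>m. real m * (1 - cos (c / sqrt (real m)))) \<longlonglongrightarrow> c\<^sup>2 / 2"
  unfolding power2_eq_square by real_asymp

text \<open>The base is compared with exp(-a/m), whose m-th power is exp(-a) for m > 0. Both bases
  have norm at most 1, so the m-th powers differ by at most m times the difference of the bases.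
  This tends to 0, since m (1 - base) tends to \<open>a\<close> for both.\<close>

lemma cos_kernel_power_tendsto:
  assumes k: "k > 0"
  shows "(\<lambda>m. (cos_kernel k (s / sqrt (real m)) / (real k)\<^sup>2) ^ m)
           \<longlonglongrightarrow> exp (- (((real k)\<^sup>2 - 1) / 12 * s\<^sup>2))"
proof -
  define a where "a = ((real k)\<^sup>2 - 1) / 12 * s\<^sup>2"
  have a: "a \<ge> 0" using k by (auto simp: a_def)
  let ?G = "\<lambda>m. cos_kernel k (s / sqrt (real m)) / (real k)\<^sup>2"
  have G: "norm (?G m) \<le> 1" for m
    using cos_kernel_le[of k] cos_kernel_nonneg[of k] k by simp
  have "(\<lambda>m. (\<Sum>i<k. \<Sum>j<k. real m * (1 - cos ((real i - real j) * s / sqrt (real m)))) / (real k)\<^sup>2)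
      \<longlonglongrightarrow> (\<Sum>i<k. \<Sum>j<k. ((real i - real j) * s)\<^sup>2 / 2) / (real k)\<^sup>2"
    by (intro tendsto_intros cos_scaled_tendsto) (use k in auto)
  also have "(\<Sum>i<k. \<Sum>j<k. ((real i - real j) * s)\<^sup>2 / 2) / (real k)\<^sup>2 =
      (\<Sum>i<k. \<Sum>j<k. (real i - real j)\<^sup>2) * s\<^sup>2 / 2 / (real k)\<^sup>2"
    by (simp add: power_mult_distrib sum_distrib_right flip: sum_divide_distrib)
  also have "\<dots> = a"
    unfolding sum_squared_differences a_def using k by (simp add: field_simps)
  also have "(\<lambda>m. (\<Sum>i<k. \<Sum>j<k. real m * (1 - cos ((real i - real j) * s / sqrt (real m)))) / (real k)\<^sup>2)
     = (\<lambda>m. real m * (1 - ?G m))"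
    using k by (simp add: cos_kernel_def sum_subtractf field_simps power2_eq_square fun_eq_iff
        flip: sum_distrib_left)
  finally have 1: "(\<lambda>m. real m * (1 - ?G m)) \<longlonglongrightarrow> a" .
  have 2: "(\<lambda>m. real m * (1 - exp (- a / real m))) \<longlonglongrightarrow> a"
    by real_asymp
  have "(\<lambda>m. \<bar>real m * (1 - exp (- a / real m)) - real m * (1 - ?G m)\<bar>) \<longlonglongrightarrow> \<bar>a - a\<bar>"
    by (intro tendsto_intros 1 2)
  then have lim: "(\<lambda>m. \<bar>real m * (1 - exp (- a / real m)) - real m * (1 - ?G m)\<bar>) \<longlonglongrightarrow> 0"
    by simp
  have "(\<lambda>m. ?G m ^ m - exp (- a / real m) ^ m) \<longlonglongrightarrow> 0"
  proof (rule Lim_null_comparison[OF always_eventually lim])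
    show "\<forall>m. norm (?G m ^ m - exp (- a / real m) ^ m) \<le>
        \<bar>real m * (1 - exp (- a / real m)) - real m * (1 - ?G m)\<bar>"
    proof
      fix m
      have "norm (?G m ^ m - exp (- a / real m) ^ m) \<le> real m * norm (?G m - exp (- a / real m))"
        by (rule norm_power_diff[OF G]) (use a in auto)
      also have "\<dots> = \<bar>real m * (?G m - exp (- a / real m))\<bar>" by (simp add: abs_mult)
      also have "\<dots> = \<bar>real m * (1 - exp (- a / real m)) - real m * (1 - ?G m)\<bar>"
        by (simp add: algebra_simps)
      finally show "norm (?G m ^ m - exp (- a / real m) ^ m) \<le>
        \<bar>real m * (1 - exp (- a / real m)) - real m * (1 - ?G m)\<bar>" .
    qed
  qed
  then have "(\<lambda>m. exp (- a / real m) ^ m + (?G m ^ m - exp (- a / real m) ^ m)) \<longlonglongrightarrow> exp (- a) + 0"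
  proof (rule tendsto_add[rotated])
    show "(\<lambda>m. exp (- a / real m) ^ m) \<longlonglongrightarrow> exp (- a)"
    proof (rule tendsto_eventually)
      \<comment> \<open>At m = 0 the power is 1, so the equality is claimed only eventually.\<close>
      show "\<forall>\<^sub>F m in sequentially. exp (- a / real m) ^ m = exp (- a)"
        using eventually_gt_at_top[of 0]
        by eventually_elim (simp flip: exp_of_nat_mult)
    qed
  qed
  then show ?thesis by (simp add: a_def)
qed

section \<open>The Gaussian integral and dominated convergence\<close>

lemma gaussian_integral:
  assumes a: "(a::real) > 0"
  shows "integrable lborel (\<lambda>s. exp (- (a * s\<^sup>2)))"
    and "(LBINT s. exp (- (a * s\<^sup>2))) = sqrt (pi / a)"
proof -
  \<comment> \<open>Chosen so that 2 \<sigma>^2 = 1/a, which makes the integrand a multiple of a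
    normal density.\<close>
  define \<sigma> where "\<sigma> = sqrt (1 / (2 * a))"
  have \<sigma>: "\<sigma> > 0" "\<sigma>\<^sup>2 = 1 / (2 * a)" using a by (auto simp: \<sigma>_def)
  have eq: "exp (- (a * s\<^sup>2)) = sqrt (pi / a) * normal_density 0 \<sigma> s" for s
    using a by (simp add: normal_density_def \<sigma> field_simps real_sqrt_divide)
  show "integrable lborel (\<lambda>s. exp (- (a * s\<^sup>2)))"
    unfolding eq using \<sigma> by (intro integrable_mult_right) simp
  show "(LBINT s. exp (- (a * s\<^sup>2))) = sqrt (pi / a)"
    unfolding eq using \<sigma> by simp
qed

lemma cos_kernel_integral_asymp:
  assumes k: "k \<ge> 2"
  shows "(\<lambda>m. sqrt (real m) *
            (LBINT t. indicator {-pi..pi} t * (cos_kernel k t / (real k)\<^sup>2) ^ m))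
           \<longlonglongrightarrow> sqrt (12 * pi / ((real k)\<^sup>2 - 1))"
proof -
  let ?G = "\<lambda>t. cos_kernel k t / (real k)\<^sup>2"
  have meas: "cos_kernel k \<in> borel_measurable borel"
    unfolding cos_kernel_def by measurable
  have k1: "(real k)\<^sup>2 > 1" using k by (simp add: one_less_power)
  let ?f = "\<lambda>m s. indicator {-pi..pi} (s / sqrt (real m)) * ?G (s / sqrt (real m)) ^ m"
  let ?w = "\<lambda>s::real. exp (- (1 / (8 * (real k)\<^sup>2) * s\<^sup>2))"
  \<comment> \<open>The index starts at 1 because \<open>?f 0\<close> is constantly 1 (division by
    zero gives 0), so it is not dominated by \<open>?w\<close>; the substitution also needs a
    nonzero scale.\<close>
  have "(\<lambda>m. LBINT s. ?f (Suc m) s) \<longlonglongrightarrow> (LBINT s. exp (- (((real k)\<^sup>2 - 1) / 12 * s\<^sup>2)))"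
  proof (rule integral_dominated_convergence[where w = ?w])
    show "integrable lborel ?w" by (rule gaussian_integral) (use k in auto)
    show "?f (Suc m) \<in> borel_measurable lborel" for m using meas by measurable
    show "AE s in lborel. (\<lambda>m. ?f (Suc m) s) \<longlonglongrightarrow> exp (- (((real k)\<^sup>2 - 1) / 12 * s\<^sup>2))"
    proof (rule AE_I2)
      fix s :: real
      \<comment> \<open>For fixed \<open>s\<close> the rescaled point eventually lies inside the
        interval, where the indicator is 1.\<close>
      have "(\<lambda>m. s / sqrt (real m)) \<longlonglongrightarrow> 0" by real_asymp
      then have "\<forall>\<^sub>F m in sequentially. s / sqrt (real m) \<in> {-pi<..<pi}"
        by (rule topological_tendstoD) auto
      then have "\<forall>\<^sub>F m in sequentially. ?f m s = ?G (s / sqrt (real m)) ^ m"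
        by eventually_elim auto
      then have "(\<lambda>m. ?f m s) \<longlonglongrightarrow> exp (- (((real k)\<^sup>2 - 1) / 12 * s\<^sup>2))"
        using cos_kernel_power_tendsto[of k s] k by (subst tendsto_cong) auto
      then show "(\<lambda>m. ?f (Suc m) s) \<longlonglongrightarrow> exp (- (((real k)\<^sup>2 - 1) / 12 * s\<^sup>2))"
        by (rule LIMSEQ_Suc)
    qed
    show "AE s in lborel. norm (?f (Suc m) s) \<le> ?w s" for m
    proof (rule AE_I2)
      fix s :: real
      define t where "t = s / sqrt (real (Suc m))"
      show "norm (?f (Suc m) s) \<le> ?w s"
      proof (cases "\<bar>t\<bar> \<le> pi")
        case True
        have "?G t ^ Suc m \<le> exp (- (t\<^sup>2 / (8 * (real k)\<^sup>2))) ^ Suc m"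
          by (intro power_mono cos_kernel_le_exp k True divide_nonneg_nonneg cos_kernel_nonneg) auto
        also have "\<dots> = exp (real (Suc m) * (- (t\<^sup>2 / (8 * (real k)\<^sup>2))))"
          by (rule exp_of_nat_mult[symmetric])
        also have "real (Suc m) * (- (t\<^sup>2 / (8 * (real k)\<^sup>2))) = - (1 / (8 * (real k)\<^sup>2) * s\<^sup>2)"
          by (simp add: t_def power_divide)
        finally show ?thesis
          unfolding t_def[symmetric]
          by (simp add: cos_kernel_nonneg indicator_def abs_mult power_abs)
      next
        case False
        then have "t \<notin> {-pi..pi}" by auto
        then show ?thesis unfolding t_def[symmetric] by simp
      qed
    qed
  qed simp
  also have "(LBINT s. exp (- (((real k)\<^sup>2 - 1) / 12 * s\<^sup>2))) = sqrt (12 * pi / ((real k)\<^sup>2 - 1))"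
    using k1 by (subst gaussian_integral) (auto simp: mult.commute)
  also have "(\<lambda>m. LBINT s. ?f (Suc m) s) =
      (\<lambda>m. sqrt (real (Suc m)) * (LBINT t. indicator {-pi..pi} t * ?G t ^ Suc m))"
  proof
    fix m
    show "(LBINT s. ?f (Suc m) s) =
        sqrt (real (Suc m)) * (LBINT t. indicator {-pi..pi} t * ?G t ^ Suc m)"
      by (subst lborel_integral_real_affine[where c = "sqrt (real (Suc m))" and t = 0]) auto
  qed
  finally show ?thesis by (rule LIMSEQ_imp_Suc)
qed

section \<open>The central binomial coefficient from Wallis's product\<close>

lemma central_binomial_asymp:
  "(\<lambda>m. real (2 * m choose m) / 4 ^ m * sqrt (real m)) \<longlonglongrightarrow> 1 / sqrt pi"
proof -
  define b where "b m = real (2 * m choose m) / 4 ^ m" for m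
  have b_Suc: "b (Suc m) = b m * ((2 * real m + 1) / (2 * (real m + 1)))" for m
  proof -
    have b: "b n = fact (2 * n) / (fact n * fact n * 4 ^ n)" for n
      unfolding b_def by (simp add: binomial_fact)
    have f: "fact (2 * Suc m) = 2 * (real m + 1) * ((2 * real m + 1) * fact (2 * m))"
      by (simp add: algebra_simps)
    have g: "(fact (Suc m) :: real) = (real m + 1) * fact m" by simp
    \<comment> \<open>Applied with \<open>v\<close> = m + 1, \<open>u\<close> = 2m + 1,
      \<open>F\<close> = (2m)!, \<open>g\<close> = m! and \<open>p\<close> = 4^m.\<close>
    have ratio: "2 * v * (u * F) / (v * g * (v * g) * (4 * p)) = F / (g * g * p) * (u / (2 * v))"
      if "v \<noteq> 0" "g \<noteq> 0" "p \<noteq> 0" for u v F g p :: real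
      using that by (simp add: field_simps)
    show ?thesis unfolding b f g power_Suc by (rule ratio) auto
  qed
  have b_pos: "b m > 0" for m by (simp add: b_def)
  \<comment> \<open>The induction step for \<open>wallis_eq\<close>, with \<open>c\<close> for
    \<open>b m\<close> and \<open>x\<close> for \<open>real m\<close>. It rests on 4y^2 - 1 = (2y -
    1)(2y + 1) at y = x + 1.\<close>
  have step: "1 / (c\<^sup>2 * (2 * x + 1)) * (4 * (x + 1)\<^sup>2 / (4 * (x + 1)\<^sup>2 - 1)) =
      1 / ((c * ((2 * x + 1) / (2 * (x + 1))))\<^sup>2 * (2 * (x + 1) + 1))"
    if "c > 0" "x \<ge> 0" for c x :: real
  proof -
    define y where "y = x + 1"
    have [simp]: "4 * y\<^sup>2 - 1 = (2 * x + 1) * (2 * y + 1)" "2 * x + 1 \<noteq> 0" "2 * y + 1 \<noteq> 0" "y \<noteq> 0" "c \<noteq> 0"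
      using that by (simp_all add: y_def power2_eq_square algebra_simps)
    show ?thesis
      unfolding y_def[symmetric] power_mult_distrib power_divide
      by (simp add: divide_simps) (simp add: power2_eq_square)
  qed
  have wallis_eq: "(\<Prod>i=1..m. (4 * real i ^ 2) / (4 * real i ^ 2 - 1)) = 1 / ((b m)\<^sup>2 * (2 * real m + 1))" for m
  proof (induction m)
    case 0
    then show ?case by (simp add: b_def)
  next
    case (Suc m)
    have "(\<Prod>i=1..Suc m. (4 * real i ^ 2) / (4 * real i ^ 2 - 1)) =
        1 / ((b m)\<^sup>2 * (2 * real m + 1)) * (4 * (real m + 1)\<^sup>2 / (4 * (real m + 1)\<^sup>2 - 1))"
      using Suc by (simp add: add.commute)
    then show ?case unfolding step[OF b_pos of_nat_0_le_iff] b_Suc by (simp add: add.commute)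
  qed
  have half: "(\<lambda>m. real m / (2 * real m + 1)) \<longlonglongrightarrow> 1 / 2" by real_asymp
  \<comment> \<open>Inverting the Wallis product gives (b m)^2 (2m + 1), which tends to 2/pi; the
    factor m/(2m + 1) turns this into (b m)^2 m, with limit 1/pi.\<close>
  have "(\<lambda>m. sqrt (inverse (1 / ((b m)\<^sup>2 * (2 * real m + 1))) * (real m / (2 * real m + 1))))
      \<longlonglongrightarrow> sqrt (inverse (pi / 2) * (1 / 2))"
    by (rule tendsto_real_sqrt[OF tendsto_mult[OF tendsto_inverse[OF wallis[unfolded wallis_eq]] half]]) simp
  also have "(\<lambda>m. sqrt (inverse (1 / ((b m)\<^sup>2 * (2 * real m + 1))) * (real m / (2 * real m + 1)))) =
      (\<lambda>m. b m * sqrt (real m))"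
  proof
    fix m
    have "inverse (1 / ((b m)\<^sup>2 * (2 * real m + 1))) * (real m / (2 * real m + 1)) = (b m)\<^sup>2 * real m"
      by (simp add: add_nonneg_eq_0_iff)
    then show "sqrt (inverse (1 / ((b m)\<^sup>2 * (2 * real m + 1))) * (real m / (2 * real m + 1))) = b m * sqrt (real m)"
      using b_pos[of m] by (simp add: real_sqrt_mult)
  qed
  finally show ?thesis by (simp add: b_def real_sqrt_divide inverse_eq_divide)
qed

section \<open>Letters and balanced sequences for even \<open>q\<close>\<close>

lemma alphabet_even_pos: "{x \<in> alphabet (2 * k). x > 0} = (\<lambda>j. 2 * int j + 1) ` {..<k}"
proof (intro equalityI subsetI)
  fix x assume "x \<in> {x \<in> alphabet (2 * k). x > 0}"
  then obtain i where "i < 2 * k" "x = 2 * int i - int (2 * k) + 1" "x > 0"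
    by (auto simp: alphabet_def)
  then show "x \<in> (\<lambda>j. 2 * int j + 1) ` {..<k}"
    by (intro image_eqI[of _ _ "i - k"]) auto
next
  fix x assume "x \<in> (\<lambda>j. 2 * int j + 1) ` {..<k}"
  then obtain j where "j < k" "x = 2 * int j + 1" by auto
  then have "x = 2 * int (j + k) - int (2 * k) + 1" "j + k < 2 * k" "x > 0" by auto
  then show "x \<in> {x \<in> alphabet (2 * k). x > 0}" unfolding alphabet_def by blast
qed

lemma alphabet_even_neg: "{x \<in> alphabet (2 * k). x < 0} = (\<lambda>j. - (2 * int j + 1)) ` {..<k}"
proof (intro equalityI subsetI)
  fix x assume "x \<in> {x \<in> alphabet (2 * k). x < 0}"
  then obtain i where "i < 2 * k" "x = 2 * int i - int (2 * k) + 1" "x < 0"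
    by (auto simp: alphabet_def)
  then show "x \<in> (\<lambda>j. - (2 * int j + 1)) ` {..<k}"
    by (intro image_eqI[of _ _ "k - 1 - i"]) auto
next
  fix x assume "x \<in> (\<lambda>j. - (2 * int j + 1)) ` {..<k}"
  then obtain j where "j < k" "x = - (2 * int j + 1)" by auto
  then have "x = 2 * int (k - 1 - j) - int (2 * k) + 1" "k - 1 - j < 2 * k" "x < 0" by auto
  then show "x \<in> {x \<in> alphabet (2 * k). x < 0}" unfolding alphabet_def by blast
qed

text \<open>Oddness is used twice: 0 is not a letter, so every entry has a sign, and a sum of evenly
  many letters is even.\<close>

lemma odd_alphabet_even: "x \<in> alphabet (2 * k) \<Longrightarrow> odd x"
  by (auto simp: alphabet_def)

lemma even_sum_list_odd_iff:
  fixes xs :: "int list"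
  assumes "\<forall>x\<in>set xs. odd x"
  shows "even (sum_list xs) \<longleftrightarrow> even (length xs)"
  using assms by (induction xs) auto

text \<open>As no entry is 0, the positive and negative entries together number 2m, so polarity
  balance means exactly \<open>m\<close> positive ones.\<close>

lemma CPB_sequences_even_eq:
  fixes k m :: nat
  defines "A \<equiv> {x \<in> alphabet (2 * k). x > 0}" and "B \<equiv> {x \<in> alphabet (2 * k). x < 0}"
  shows "CPB_sequences (2 * m) (2 * k) =
           {xs \<in> lists_with_count A B (2 * m) m. sum_list xs = 0}"
proof -
  have sign: "x > 0 \<or> x < 0" if "x \<in> alphabet (2 * k)" for x
    using odd_alphabet_even[OF that] by (cases "x = 0") auto
  then have AB: "A \<union> B = alphabet (2 * k)"
    by (auto simp: A_def B_def)
  have "polarity_balanced xs \<longleftrightarrow> length (filter (\<lambda>x. x \<in> A) xs) = m"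
    if xs: "length xs = 2 * m" "set xs \<subseteq> alphabet (2 * k)" for xs
  proof -
    have pos: "filter (\<lambda>x. x \<in> A) xs = filter (\<lambda>x. x > 0) xs"
      using xs by (intro filter_cong) (auto simp: A_def)
    have neg: "filter (\<lambda>x. \<not> x > 0) xs = filter (\<lambda>x. x < 0) xs"
      using xs sign by (intro filter_cong) (force, force)
    have "length (filter (\<lambda>x. x > 0) xs) + length (filter (\<lambda>x. x < 0) xs) = 2 * m"
      using sum_length_filter_compl[of "\<lambda>x. x > 0" xs] xs unfolding neg by simp
    then show ?thesis
      unfolding polarity_balanced_def pos by (auto simp: length_filter_conv_card)
  qed
  then show ?thesis
    by (auto simp: CPB_sequences_def lists_with_count_def AB charge_balanced_def)
qed

section \<open>Integral formula for the count\<close>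

lemma M_CPB_even_eq_integral:
  "real (M_CPB (2 * m) (2 * k)) =
     real (2 * m choose m) / (2 * pi) * (LBINT t. indicator {-pi..pi} t * cos_kernel k t ^ m)"
proof -
  define A where "A = {x \<in> alphabet (2 * k). x > 0}"
  define B where "B = {x \<in> alphabet (2 * k). x < 0}"
  let ?L = "lists_with_count A B (2 * m) m"
  have fin: "finite A" "finite B"
    unfolding A_def B_def alphabet_even_pos alphabet_even_neg by auto
  have disj: "A \<inter> B = {}" by (auto simp: A_def B_def)
  \<comment> \<open>Half of the sum is an integer, since the list has evenly many odd entries; hence
    frequencies halved this way are still orthogonal over [-pi, pi].\<close>
  have detect: "(LBINT t. indicator {-pi..pi} t * cos (t * (of_int (sum_list xs) / 2))) =
      (if sum_list xs = 0 then 2 * pi else 0)" if "xs \<in> ?L" for xs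
  proof -
    have "even (sum_list xs)"
      using that by (subst even_sum_list_odd_iff)
        (auto simp: lists_with_count_def A_def B_def dest!: odd_alphabet_even)
    then obtain z where "sum_list xs = 2 * z" by blast
    then show ?thesis using integral_cos_int[of z] by simp
  qed
  \<comment> \<open>Weighting a letter \<open>x\<close> by cis(t x/2) turns the letters into the
    frequencies j + 1/2 and -(j + 1/2). The m positive and m negative places pair up to the m-th
    power of the kernel; real parts give the cosines.\<close>
  have kernel: "(\<Sum>xs\<in>?L. cos (t * (of_int (sum_list xs) / 2))) =
      real (2 * m choose m) * cos_kernel k t ^ m" for t
  proof -
    let ?g = "\<lambda>x. cis (t * (of_int x / 2))"
    have "(\<Sum>x\<leftarrow>xs. t * (of_int x / 2)) = t * (of_int (sum_list xs) / 2)" for xs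
      by (induction xs) (auto simp: field_simps)
    then have "(\<Sum>xs\<in>?L. cis (t * (of_int (sum_list xs) / 2))) =
        (\<Sum>xs\<in>?L. prod_list (map ?g xs))"
      by (simp only: prod_list_cis)
    also have "\<dots> = of_nat (2 * m choose m) * (sum ?g A * sum ?g B) ^ m"
      by (subst sum_prod_list_lists_with_count[OF fin disj]) (simp add: power_mult_distrib)
    also have "sum ?g A = (\<Sum>j<k. cis (t * (real j + 1 / 2)))"
      unfolding A_def alphabet_even_pos
      by (subst sum.reindex) (auto simp: inj_on_def field_simps intro!: sum.cong arg_cong[of _ _ cis])
    also have "sum ?g B = (\<Sum>j<k. cis (- (t * (real j + 1 / 2))))"
      unfolding B_def alphabet_even_neg
      by (subst sum.reindex) (auto simp: inj_on_def field_simps intro!: sum.cong arg_cong[of _ _ cis])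
    finally have "Re (\<Sum>xs\<in>?L. cis (t * (of_int (sum_list xs) / 2))) =
        Re (of_real (real (2 * m choose m) * cos_kernel k t ^ m))"
      unfolding sum_cis_mult_sum_cis by simp
    then show ?thesis by simp
  qed
  have int: "integrable lborel (\<lambda>t. indicator {-pi..pi} t * cos (t * c))" for c
    using borel_integrable_atLeastAtMost'[of "-pi" pi "\<lambda>t. cos (t * c)"]
    by (simp add: set_integrable_def continuous_on_cos continuous_on_mult_right)
  have "2 * pi * real (M_CPB (2 * m) (2 * k)) =
      (\<Sum>xs\<in>?L. if sum_list xs = 0 then 2 * pi else 0)"
    unfolding M_CPB_def CPB_sequences_even_eq A_def[symmetric] B_def[symmetric]
    by (simp add: sum.If_cases finite_lists_with_count[OF fin] Int_def)
  also have "\<dots> = (\<Sum>xs\<in>?L. LBINT t. indicator {-pi..pi} t * cos (t * (of_int (sum_list xs) / 2)))"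
    by (intro sum.cong refl detect[symmetric])
  also have "\<dots> = (LBINT t. \<Sum>xs\<in>?L. indicator {-pi..pi} t * cos (t * (of_int (sum_list xs) / 2)))"
    by (intro Bochner_Integration.integral_sum[symmetric] int)
  also have "\<dots> = (LBINT t. real (2 * m choose m) * (indicator {-pi..pi} t * cos_kernel k t ^ m))"
    unfolding sum_distrib_left[symmetric] kernel by (simp add: mult_ac)
  also have "\<dots> = real (2 * m choose m) * (LBINT t. indicator {-pi..pi} t * cos_kernel k t ^ m)"
    by simp
  finally show ?thesis by (simp add: field_simps)
qed

section \<open>Assembling the asymptotics\<close>

lemma M_CPB_even_asymp:
  assumes k: "k \<ge> 2"
  shows "(\<lambda>m. real (M_CPB (2 * m) (2 * k)) /
            (real (2 * k) ^ (2 * m) * (1 / (pi * real (2 * m))) * sqrt (48 / ((real (2 * k))\<^sup>2 - 4))))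
          \<longlonglongrightarrow> 1"
proof -
  define D where "D = (real k)\<^sup>2 - 1"
  have D: "D > 0" using k by (simp add: D_def one_less_power)
  define J where "J m = (LBINT t. indicator {-pi..pi} t * (cos_kernel k t / (real k)\<^sup>2) ^ m)" for m
  \<comment> \<open>The last factor normalises the product of the two limits to 1. As q^2 - 4 = 4 D
    for q = 2k, it is the reciprocal of the square root in the claim.\<close>
  have "(\<lambda>m. (real (2 * m choose m) / 4 ^ m * sqrt (real m)) * (sqrt (real m) * J m) * sqrt (D / 12))
      \<longlonglongrightarrow> 1 / sqrt pi * sqrt (12 * pi / D) * sqrt (D / 12)"
    unfolding J_def D_def
    by (intro tendsto_intros central_binomial_asymp cos_kernel_integral_asymp k)
  also have "1 / sqrt pi * sqrt (12 * pi / D) * sqrt (D / 12) = 1"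
    using D by (simp add: real_sqrt_divide real_sqrt_mult)
  also have "(\<lambda>m. (real (2 * m choose m) / 4 ^ m * sqrt (real m)) * (sqrt (real m) * J m) * sqrt (D / 12)) =
      (\<lambda>m. real (M_CPB (2 * m) (2 * k)) /
            (real (2 * k) ^ (2 * m) * (1 / (pi * real (2 * m))) * sqrt (48 / ((real (2 * k))\<^sup>2 - 4))))"
  proof
    fix m
    have "(LBINT t. indicator {-pi..pi} t * cos_kernel k t ^ m) = real k ^ (2 * m) * J m"
      unfolding J_def integral_mult_right_zero[symmetric] using k
      by (intro Bochner_Integration.integral_cong refl) (simp add: power_divide power_mult)
    then have M: "real (M_CPB (2 * m) (2 * k)) =
        real (2 * m choose m) / (2 * pi) * (real k ^ (2 * m) * J m)"
      by (simp only: M_CPB_even_eq_integral)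
    have sq: "sqrt (48 / ((real (2 * k))\<^sup>2 - 4)) = 1 / sqrt (D / 12)"
    proof -
      have "48 / ((real (2 * k))\<^sup>2 - 4) = 12 / D"
        using D by (simp add: D_def power_mult_distrib field_simps)
      then show ?thesis by (simp only: real_sqrt_divide) simp
    qed
    have pw: "real (2 * k) ^ (2 * m) = 4 ^ m * real k ^ (2 * m)"
      by (simp add: power_mult_distrib power_mult)
    have "sqrt (real m) * sqrt (real m) = real m" by simp
    then have "(real (2 * m choose m) / 4 ^ m * sqrt (real m)) * (sqrt (real m) * J m) =
        real (2 * m choose m) / 4 ^ m * real m * J m"
      by (metis mult.assoc mult.left_commute)
    \<comment> \<open>This holds at m = 0 too: the left side contains \<open>sqrt 0\<close>, and on
      the right division by zero gives 0.\<close>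
    then show "(real (2 * m choose m) / 4 ^ m * sqrt (real m)) * (sqrt (real m) * J m) * sqrt (D / 12) =
      real (M_CPB (2 * m) (2 * k)) /
            (real (2 * k) ^ (2 * m) * (1 / (pi * real (2 * m))) * sqrt (48 / ((real (2 * k))\<^sup>2 - 4)))"
      unfolding M sq pw using k D by (auto simp: divide_simps)
  qed
  finally show ?thesis .
qed

theorem theorem9:
  fixes q :: nat
  assumes "q \<ge> 4" and "even q"
  shows "((\<lambda>n::nat. real (M_CPB n q) /
            (real q ^ n * (1 / (pi * real n)) * sqrt (48 / ((real q)\<^sup>2 - 4))))
          \<longlongrightarrow> 1) (inf sequentially (principal {n. even n}))"
proof -
  from assms(2) obtain k where q: "q = 2 * k" by (rule evenE)
  have k: "k \<ge> 2" using assms(1) q by simp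
  define f where "f n = real (M_CPB n q) /
    (real q ^ n * (1 / (pi * real n)) * sqrt (48 / ((real q)\<^sup>2 - 4)))" for n
  \<comment> \<open>The limit along \<open>2 * m\<close> is pulled back by \<open>n div 2\<close>;
    on even \<open>n\<close>, \<open>2 * (n div 2)\<close> is \<open>n\<close> itself.\<close>
  have half: "filterlim (\<lambda>n::nat. n div 2) sequentially sequentially"
    unfolding filterlim_at_top eventually_sequentially
  proof
    fix Z :: nat
    show "\<exists>N. \<forall>n\<ge>N. Z \<le> n div 2" by (intro exI[of _ "2 * Z"]) auto
  qed
  have "(\<lambda>m. f (2 * m)) \<longlonglongrightarrow> 1"
    unfolding f_def q by (rule M_CPB_even_asymp[OF k])
  then have "(\<lambda>n. f (2 * (n div 2))) \<longlonglongrightarrow> 1"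
    using half by (rule filterlim_compose)
  then have "((\<lambda>n. f (2 * (n div 2))) \<longlongrightarrow> 1) (inf sequentially (principal {n. even n}))"
    by (rule tendsto_mono[OF inf_le1])
  moreover have "\<forall>\<^sub>F n in inf sequentially (principal {n. even n}). f (2 * (n div 2)) = f n"
    by (simp add: eventually_inf_principal)
  ultimately have "(f \<longlongrightarrow> 1) (inf sequentially (principal {n. even n}))"
    by (rule Lim_transform_eventually)
  then show ?thesis unfolding f_def .
qed

end
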